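(* Let $\mathcal{H}_K$ be a reproducing kernel Hilbert space of functions $f:\Omega\to\mathbb{C}$ with reproducing kernel $K$, and let $\Psi=\{\psi_i\}_{i\in\mathcal{I}}$ and $\Phi=\{\phi_i\}_{i\in\mathcal{I}}$ be families in $\mathcal{H}_K$, indexed by a countable set $\mathcal{I}$. The pair $(\Psi,\Phi)$ is a reproducing pair for $\mathcal{H}_K$ if and only if there exists $A\in GL(\mathcal{H}_K)$ such that $$K(z,w)=\sum_{i\in\mathcal{I}}(A\phi_i)(z)\,\overline{\psi_i(w)}=\sum_{i\in\mathcal{I}}(A^*\psi_i)(z)\,\overline{\phi_i(w)},\qquad \forall z,w\in\Omega,$$ where the series converge pointwise. In particular, $A$ is uniquely given by $A=S_{\Psi,\Phi}^{-1}$.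
   Context: Inner products are linear in the first argument. $GL(\mathcal{H})$ is the set of bounded linear operators on $\mathcal{H}$ with bounded inverse. A Hilbert space $\mathcal{H}_K$ of functions $f:\Omega\to\mathbb{C}$ is a reproducing kernel Hilbert space (RKHS) if for every $z\in\Omega$ the point evaluation $f\mapsto f(z)$ is bounded; then $f(z)=\langle f,k_z\rangle$ for a unique $k_z\in\mathcal{H}_K$, and the reproducing kernel is $K(z,w):=k_w(z)=\langle k_w,k_z\rangle$. For families $\Psi=\{\psi_i\}_{i\in\mathcal{I}}$, $\Phi=\{\phi_i\}_{i\in\mathcal{I}}$ in a (separable) Hilbert space $\mathcal{H}$, the pair $(\Psi,\Phi)$ is a reproducing pair for $\mathcal{H}$ if the operator $S_{\Psi,\Phi}:\mathcal{H}\to\mathcal{H}$ defined weakly by $$\langle S_{\Psi,\Phi}f,g\rangle:=\sum_{i\in\mathcal{I}}\langle f,\psi_i\rangle\langle\phi_i,g\rangle,\qquad f,g\in\mathcal{H},$$ is an element of $GL(\mathcal{H})$.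
   Formalization: It is additionally assumed that the series defining ⟨S_{Ψ,Φ}f,g⟩ converges (unconditionally) for all f,g in H_K; pointwise convergence of the kernel series does not imply this, and without it the "if" direction fails. *)

theory Defs
  imports "HOL-Analysis.Analysis" "HOL-Library.Function_Algebras"
begin

text \<open>
  A Hilbert space of complex-valued functions is given by its carrier \<open>H\<close> and its inner product
  \<open>ip\<close>, linear in the first argument; only the values of \<open>ip\<close> on \<open>H\<close> are constrained. The domain
  \<open>\<Omega>\<close> of the functions is the type \<open>'z\<close>. The sum \<open>f + g\<close>, the difference and \<open>0\<close> are the pointwise
  ones of \<open>HOL-Library.Function_Algebras\<close>.
\<close>

type_synonym 'z inner_prod = "('z \<Rightarrow> complex) \<Rightarrow> ('z \<Rightarrow> complex) \<Rightarrow> complex"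

definition hnorm :: "'z inner_prod \<Rightarrow> ('z \<Rightarrow> complex) \<Rightarrow> real" where
  "hnorm ip f = sqrt (Re (ip f f))"

locale function_hilbert_space =
  fixes H :: "('z \<Rightarrow> complex) set" and ip :: "'z inner_prod"
  assumes zero_mem: "0 \<in> H"
    and add_mem: "\<lbrakk>f \<in> H; g \<in> H\<rbrakk> \<Longrightarrow> f + g \<in> H"
    and scale_mem: "f \<in> H \<Longrightarrow> (\<lambda>z. c * f z) \<in> H"
    and ip_add: "\<lbrakk>f \<in> H; g \<in> H; h \<in> H\<rbrakk> \<Longrightarrow> ip (f + g) h = ip f h + ip g h"
    and ip_scale: "\<lbrakk>f \<in> H; h \<in> H\<rbrakk> \<Longrightarrow> ip (\<lambda>z. c * f z) h = c * ip f h"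
    and ip_commute: "\<lbrakk>f \<in> H; g \<in> H\<rbrakk> \<Longrightarrow> ip g f = cnj (ip f g)"
    and ip_pos: "\<lbrakk>f \<in> H; f \<noteq> 0\<rbrakk> \<Longrightarrow> Re (ip f f) > 0"
    and complete: "\<lbrakk>\<And>n::nat. X n \<in> H;
        \<And>e. e > 0 \<Longrightarrow> \<exists>N. \<forall>m\<ge>N. \<forall>n\<ge>N. hnorm ip (X m - X n) < e\<rbrakk>
      \<Longrightarrow> \<exists>f\<in>H. (\<lambda>n. hnorm ip (X n - f)) \<longlonglongrightarrow> 0"

locale rkhs = function_hilbert_space H ip
  for H :: "('z \<Rightarrow> complex) set" and ip :: "'z inner_prod" +
  assumes bounded_eval: "\<exists>C. \<forall>f\<in>H. cmod (f z) \<le> C * hnorm ip f"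

definition kernel_fun :: "('z \<Rightarrow> complex) set \<Rightarrow> 'z inner_prod \<Rightarrow> 'z \<Rightarrow> ('z \<Rightarrow> complex)" where
  "kernel_fun H ip w = (THE k. k \<in> H \<and> (\<forall>f\<in>H. f w = ip f k))"

definition repr_kernel :: "('z \<Rightarrow> complex) set \<Rightarrow> 'z inner_prod \<Rightarrow> 'z \<Rightarrow> 'z \<Rightarrow> complex" where
  "repr_kernel H ip z w = kernel_fun H ip w z"

text \<open>
  Operators on \<open>H\<close> are total HOL functions of which only the restriction to \<open>H\<close> matters; two
  operators are the same if they agree on \<open>H\<close>.
\<close>

definition bounded_operator ::
    "('z \<Rightarrow> complex) set \<Rightarrow> 'z inner_prod \<Rightarrow> (('z \<Rightarrow> complex) \<Rightarrow> ('z \<Rightarrow> complex)) \<Rightarrow> bool" where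
  "bounded_operator H ip A \<longleftrightarrow>
     A \<in> H \<rightarrow> H \<and>
     (\<forall>f\<in>H. \<forall>g\<in>H. A (f + g) = A f + A g) \<and>
     (\<forall>c. \<forall>f\<in>H. A (\<lambda>z. c * f z) = (\<lambda>z. c * A f z)) \<and>
     (\<exists>C. \<forall>f\<in>H. hnorm ip (A f) \<le> C * hnorm ip f)"

definition GL ::
    "('z \<Rightarrow> complex) set \<Rightarrow> 'z inner_prod \<Rightarrow> (('z \<Rightarrow> complex) \<Rightarrow> ('z \<Rightarrow> complex)) set" where
  "GL H ip = {A. bounded_operator H ip A \<and>
     (\<exists>B. bounded_operator H ip B \<and> (\<forall>f\<in>H. B (A f) = f \<and> A (B f) = f))}"

definition hadjoint :: "('z \<Rightarrow> complex) set \<Rightarrow> 'z inner_prod \<Rightarrow>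
    (('z \<Rightarrow> complex) \<Rightarrow> ('z \<Rightarrow> complex)) \<Rightarrow> ('z \<Rightarrow> complex) \<Rightarrow> ('z \<Rightarrow> complex)" where
  "hadjoint H ip A g = (THE h. h \<in> H \<and> (\<forall>f\<in>H. ip (A f) g = ip f h))"

text \<open>
  Since an index set carries no order, series over it are unordered sums (\<open>has_sum\<close>).
  \<open>frame_series_converge\<close> says that all the series defining the operator \<open>S\<^sub>\<Psi>\<^sub>,\<^sub>\<Phi>\<close> weakly
  converge. \<open>frame_operator\<close> is meaningful only when they do.
\<close>

definition frame_series_converge :: "('z \<Rightarrow> complex) set \<Rightarrow> 'z inner_prod \<Rightarrow> 'i set \<Rightarrow>
    ('i \<Rightarrow> 'z \<Rightarrow> complex) \<Rightarrow> ('i \<Rightarrow> 'z \<Rightarrow> complex) \<Rightarrow> bool" where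
  "frame_series_converge H ip I \<psi> \<phi> \<longleftrightarrow>
     (\<forall>f\<in>H. \<forall>g\<in>H. (\<lambda>i. ip f (\<psi> i) * ip (\<phi> i) g) summable_on I)"

definition frame_operator :: "('z \<Rightarrow> complex) set \<Rightarrow> 'z inner_prod \<Rightarrow> 'i set \<Rightarrow>
    ('i \<Rightarrow> 'z \<Rightarrow> complex) \<Rightarrow> ('i \<Rightarrow> 'z \<Rightarrow> complex) \<Rightarrow> ('z \<Rightarrow> complex) \<Rightarrow> ('z \<Rightarrow> complex)" where
  "frame_operator H ip I \<psi> \<phi> f =
     (THE h. h \<in> H \<and> (\<forall>g\<in>H. ((\<lambda>i. ip f (\<psi> i) * ip (\<phi> i) g) has_sum ip h g) I))"

definition reproducing_pair :: "('z \<Rightarrow> complex) set \<Rightarrow> 'z inner_prod \<Rightarrow> 'i set \<Rightarrow>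
    ('i \<Rightarrow> 'z \<Rightarrow> complex) \<Rightarrow> ('i \<Rightarrow> 'z \<Rightarrow> complex) \<Rightarrow> bool" where
  "reproducing_pair H ip I \<psi> \<phi> \<longleftrightarrow>
     (\<forall>f\<in>H. \<forall>g\<in>H. ((\<lambda>i. ip f (\<psi> i) * ip (\<phi> i) g) has_sum
        ip (frame_operator H ip I \<psi> \<phi> f) g) I) \<and>
     frame_operator H ip I \<psi> \<phi> \<in> GL H ip"

definition kernel_expansion :: "('z \<Rightarrow> complex) set \<Rightarrow> 'z inner_prod \<Rightarrow> 'i set \<Rightarrow>
    ('i \<Rightarrow> 'z \<Rightarrow> complex) \<Rightarrow> ('i \<Rightarrow> 'z \<Rightarrow> complex) \<Rightarrow>
    (('z \<Rightarrow> complex) \<Rightarrow> ('z \<Rightarrow> complex)) \<Rightarrow> bool" where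
  "kernel_expansion H ip I \<psi> \<phi> A \<longleftrightarrow>
     (\<forall>z w. ((\<lambda>i. A (\<phi> i) z * cnj (\<psi> i w)) has_sum repr_kernel H ip z w) I \<and>
            ((\<lambda>i. hadjoint H ip A (\<psi> i) z * cnj (\<phi> i w)) has_sum repr_kernel H ip z w) I)"

end

theory Submission
  imports Defs
begin

text \<open>
  Testing a weakly defined operator \<open>S\<close> against kernel functions gives
  \<open>\<Sum>\<^sub>i (A \<phi>\<^sub>i)(z) cnj (\<psi>\<^sub>i(w)) = \<langle>S k\<^sub>w, A\<^sup>* k\<^sub>z\<rangle> = (A S k\<^sub>w)(z)\<close>, so the first expansion of \<open>K\<close> says
  that \<open>A S\<close> fixes every kernel function. Two applications of the uniform boundedness principle show
  that \<open>S\<close> is bounded as soon as its defining series converge; hence \<open>A S\<close> has an adjoint, which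
  by the reproducing property is the identity, and \<open>A S = 1\<close>.
\<close>

section \<open>Hilbert spaces of functions\<close>

context function_hilbert_space
begin

abbreviation nrm :: "('z \<Rightarrow> complex) \<Rightarrow> real" where
  "nrm \<equiv> hnorm ip"

section \<open>Algebra of the inner product and its norm\<close>

lemma uminus_mem: "f \<in> H \<Longrightarrow> - f \<in> H"
  using scale_mem[of f "-1"] by (simp add: fun_Compl_def)

lemma diff_mem: "f \<in> H \<Longrightarrow> g \<in> H \<Longrightarrow> f - g \<in> H"
  using add_mem[of f "- g"] uminus_mem[of g] by simp

lemma ip_uminus: "f \<in> H \<Longrightarrow> h \<in> H \<Longrightarrow> ip (- f) h = - ip f h"
  using ip_scale[of f h "-1"] by (simp add: fun_Compl_def)

lemma ip_diff: "f \<in> H \<Longrightarrow> g \<in> H \<Longrightarrow> h \<in> H \<Longrightarrow> ip (f - g) h = ip f h - ip g h"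
  using ip_add[of f "- g" h] by (simp add: uminus_mem ip_uminus)

lemma ip_zero: "h \<in> H \<Longrightarrow> ip 0 h = 0"
  using ip_add[of 0 0 h] zero_mem by simp

lemma ip_zero_right: "h \<in> H \<Longrightarrow> ip h 0 = 0"
  using ip_commute[of 0 h] ip_zero zero_mem by simp

lemma ip_add_right: "f \<in> H \<Longrightarrow> g \<in> H \<Longrightarrow> h \<in> H \<Longrightarrow> ip h (f + g) = ip h f + ip h g"
  by (metis add_mem complex_cnj_add ip_add ip_commute)

lemma ip_diff_right: "f \<in> H \<Longrightarrow> g \<in> H \<Longrightarrow> h \<in> H \<Longrightarrow> ip h (f - g) = ip h f - ip h g"
  by (metis diff_mem complex_cnj_diff ip_diff ip_commute)

lemma ip_scale_right: "f \<in> H \<Longrightarrow> h \<in> H \<Longrightarrow> ip h (\<lambda>z. c * f z) = cnj c * ip h f"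
  by (metis scale_mem complex_cnj_mult ip_scale ip_commute)

lemma ip_self_nonneg: "f \<in> H \<Longrightarrow> 0 \<le> Re (ip f f)"
  using ip_pos[of f] ip_zero[OF zero_mem] by (cases "f = 0") auto

lemma hnorm_nonneg: "f \<in> H \<Longrightarrow> 0 \<le> nrm f"
  by (simp add: hnorm_def ip_self_nonneg)

lemma hnorm_square: "f \<in> H \<Longrightarrow> (nrm f)\<^sup>2 = Re (ip f f)"
  by (simp add: hnorm_def ip_self_nonneg)

lemma ip_self: "f \<in> H \<Longrightarrow> ip f f = of_real ((nrm f)\<^sup>2)"
  using ip_commute[of f f] by (simp add: hnorm_square complex_eq_iff)

lemma hnorm_zero: "nrm 0 = 0"
  by (simp add: hnorm_def ip_zero zero_mem)

lemma hnorm_eq_0_iff: "f \<in> H \<Longrightarrow> nrm f = 0 \<longleftrightarrow> f = 0"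
  using ip_pos[of f] hnorm_square[of f] hnorm_zero by force

lemma hnorm_scale:
  assumes "f \<in> H"
  shows "nrm (\<lambda>z. c * f z) = cmod c * nrm f"
proof -
  have "ip (\<lambda>z. c * f z) (\<lambda>z. c * f z) = (c * cnj c) * ip f f"
    using assms by (simp add: ip_scale ip_scale_right scale_mem)
  also have "\<dots> = of_real ((cmod c * nrm f)\<^sup>2)"
    using assms by (simp add: ip_self complex_norm_square power_mult_distrib flip: of_real_power)
  finally show ?thesis
    using assms by (simp add: hnorm_def[of ip "\<lambda>z. c * f z"] hnorm_nonneg)
qed

lemma hnorm_minus_commute:
  assumes "f \<in> H" "g \<in> H"
  shows "nrm (f - g) = nrm (g - f)"
  using hnorm_scale[OF diff_mem[OF assms], of "-1"] by (simp add: fun_diff_def minus_apply)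

text \<open>Expanding the nonnegative number ||G f - a g||^2 with G = ||g||^2 and a = <f, g> gives G
  (G ||f||^2 - |a|^2), and the positive factor G cancels. Scaling f by G in place of dividing by it
  keeps the computation polynomial.\<close>

lemma Cauchy_Schwarz:
  assumes "f \<in> H" "g \<in> H"
  shows "cmod (ip f g) \<le> nrm f * nrm g"
proof (cases "g = 0")
  case True
  then show ?thesis using assms by (simp add: ip_zero_right hnorm_zero)
next
  case False
  define a where "a = ip f g"
  define G where "G = (nrm g)\<^sup>2"
  define h where "h = (\<lambda>z. of_real G * f z) - (\<lambda>z. a * g z)"
  have G: "G > 0"
    using False assms ip_pos by (simp add: G_def hnorm_square)
  have h: "h \<in> H" using assms by (simp add: h_def diff_mem scale_mem)
  have "ip h h = G * (G * ip f f) - G * (cnj a * ip f g) - (a * (G * ip g f) - a * (cnj a * ip g g))"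
    using assms
    by (simp add: h_def ip_diff ip_diff_right ip_scale ip_scale_right scale_mem diff_mem
        right_diff_distrib)
  also have "\<dots> = G * G * ip f f - G * cnj a * a - a * G * ip g f + a * cnj a * ip g g"
    by (simp add: a_def algebra_simps)
  also have "\<dots> = of_real (G * (G * (nrm f)\<^sup>2)) - of_real G * (a * cnj a)"
    using assms ip_commute[of f g] by (simp add: ip_self a_def G_def algebra_simps)
  also have "\<dots> = of_real (G * (G * (nrm f)\<^sup>2 - (cmod a)\<^sup>2))"
    unfolding complex_norm_square[symmetric] by (simp add: algebra_simps)
  finally have "ip h h = of_real (G * (G * (nrm f)\<^sup>2 - (cmod a)\<^sup>2))" .
  then have "0 \<le> G * (G * (nrm f)\<^sup>2 - (cmod a)\<^sup>2)"
    using ip_self_nonneg[OF h] by (metis Re_complex_of_real)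
  then have "(cmod a)\<^sup>2 \<le> (nrm f * nrm g)\<^sup>2"
    using G by (simp add: zero_le_mult_iff power_mult_distrib G_def mult.commute)
  then show ?thesis
    using assms by (simp add: a_def hnorm_nonneg power2_le_iff_abs_le)
qed

lemma hnorm_add_square:
  assumes "f \<in> H" "g \<in> H"
  shows "(nrm (f + g))\<^sup>2 = (nrm f)\<^sup>2 + (nrm g)\<^sup>2 + 2 * Re (ip f g)"
  using assms ip_commute[of f g] by (simp add: hnorm_square add_mem ip_add ip_add_right)

lemma hnorm_triangle:
  assumes "f \<in> H" "g \<in> H"
  shows "nrm (f + g) \<le> nrm f + nrm g"
proof -
  have "(nrm (f + g))\<^sup>2 = (nrm f)\<^sup>2 + (nrm g)\<^sup>2 + 2 * Re (ip f g)"
    by (rule hnorm_add_square[OF assms])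
  also have "\<dots> \<le> (nrm f + nrm g)\<^sup>2"
    using Cauchy_Schwarz[OF assms] complex_Re_le_cmod[of "ip f g"]
    by (simp add: power2_sum)
  finally show ?thesis
    using assms by (auto intro: power2_le_imp_le add_nonneg_nonneg hnorm_nonneg)
qed

lemma hnorm_triangle_diff:
  assumes "f \<in> H" "g \<in> H" "h \<in> H"
  shows "nrm (f - h) \<le> nrm (f - g) + nrm (g - h)"
  using hnorm_triangle[of "f - g" "g - h"] assms by (simp add: diff_mem)

text \<open>Positivity applied to f - g. Together with its right-hand counterpart this supplies the
  uniqueness behind the definite descriptions \<open>kernel_fun\<close>, \<open>hadjoint\<close> and
  \<open>frame_operator\<close>.\<close>

lemma ip_left_eqI:
  assumes "f \<in> H" "g \<in> H" "\<And>h. h \<in> H \<Longrightarrow> ip f h = ip g h"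
  shows "f = g"
proof -
  have "ip (f - g) (f - g) = 0"
    using assms by (simp add: ip_diff diff_mem)
  then show ?thesis
    using ip_pos[of "f - g"] assms diff_mem by force
qed

lemma ip_right_eqI:
  assumes "f \<in> H" "g \<in> H" "\<And>h. h \<in> H \<Longrightarrow> ip h f = ip h g"
  shows "f = g"
  using assms ip_left_eqI ip_commute by metis

section \<open>Bounded functionals\<close>

text \<open>Linearity is demanded on the carrier \<open>H\<close> only. Maps that are
  conjugate-linear in their variable are brought into this form by composing with
  \<open>cnj\<close>.\<close>

definition bounded_functional :: "(('z \<Rightarrow> complex) \<Rightarrow> complex) \<Rightarrow> bool" where
  "bounded_functional L \<longleftrightarrow>
     (\<forall>f\<in>H. \<forall>g\<in>H. L (f + g) = L f + L g) \<and>
     (\<forall>c. \<forall>f\<in>H. L (\<lambda>z. c * f z) = c * L f) \<and>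
     (\<exists>C. \<forall>f\<in>H. cmod (L f) \<le> C * nrm f)"

lemma bounded_functional_bound:
  assumes "bounded_functional L"
  obtains C where "C > 0" "\<And>f. f \<in> H \<Longrightarrow> cmod (L f) \<le> C * nrm f"
proof -
  obtain C where C: "\<forall>f\<in>H. cmod (L f) \<le> C * nrm f"
    using assms by (auto simp: bounded_functional_def)
  have "cmod (L f) \<le> (\<bar>C\<bar> + 1) * nrm f" if "f \<in> H" for f
    using C that hnorm_nonneg[OF that] by (smt (verit) mult_right_mono)
  then show ?thesis using that[of "\<bar>C\<bar> + 1"] by simp
qed

lemma bounded_functional_diff:
  assumes "bounded_functional L" "f \<in> H" "g \<in> H"
  shows "L (f - g) = L f - L g"
proof -
  have "L ((f - g) + g) = L (f - g) + L g"
    using assms diff_mem unfolding bounded_functional_def by blast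
  then show ?thesis by simp
qed

text \<open>Banach-Steinhaus by nested closed balls: were there no uniform bound, every ball would
  contain a smaller one on which some \<open>L j\<close> is large. Repeating this with growing
  thresholds and shrinking radii gives a Cauchy sequence of centres, and at its limit the family is
  unbounded.\<close>

theorem uniform_boundedness:
  assumes L: "\<And>j. j \<in> J \<Longrightarrow> bounded_functional (L j)"
    and ptw: "\<And>f. f \<in> H \<Longrightarrow> \<exists>C. \<forall>j\<in>J. cmod (L j f) \<le> C"
  shows "\<exists>C. \<forall>j\<in>J. \<forall>f\<in>H. cmod (L j f) \<le> C * nrm f"
proof (rule ccontr)
  assume contr: "\<not> ?thesis"
  \<comment> \<open>The witness is one of the points x + h and x - h with ||h|| = r: the values of
    \<open>L j\<close> there differ by 2 \<open>L j h\<close>, so they cannot both be at most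
    \<open>C\<close> in modulus once |\<open>L j h\<close>| > 2|C|.\<close>
  have large: "\<exists>x'\<in>H. \<exists>j\<in>J. nrm (x' - x) \<le> r \<and> cmod (L j x') > C"
    if x: "x \<in> H" and r: "r > 0" for x r C
  proof -
    \<comment> \<open>The bound that fails is taken to be 2|C|/r, so that rescaling \<open>f\<close>
      to length \<open>r\<close> makes |\<open>L j h\<close>| exceed 2|C|.\<close>
    obtain j f where j: "j \<in> J" and f: "f \<in> H"
      and big: "cmod (L j f) > (2 * \<bar>C\<bar> / r) * nrm f"
      using contr by (meson not_le)
    note Lj = L[OF j]
    have "f \<noteq> 0"
    proof
      assume "f = 0"
      with bounded_functional_diff[OF Lj zero_mem zero_mem] big show False
        by (simp add: hnorm_zero)
    qed
    then have nf: "nrm f > 0"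
      using f hnorm_eq_0_iff hnorm_nonneg by (metis less_eq_real_def)
    define c where "c = complex_of_real (r / nrm f)"
    have c: "cmod c = r / nrm f" using nf r by (simp add: c_def norm_divide)
    define h where "h = (\<lambda>z. c * f z)"
    have h: "h \<in> H" using f by (simp add: h_def scale_mem)
    have nh: "nrm h = r" using f nf by (simp add: h_def hnorm_scale c)
    have "L j h = c * L j f"
      using Lj f by (simp add: h_def bounded_functional_def)
    then have "cmod (L j h) = r / nrm f * cmod (L j f)"
      by (simp add: norm_mult c)
    also have "r / nrm f * cmod (L j f) > r / nrm f * (2 * \<bar>C\<bar> / r * nrm f)"
      using big r nf by (intro mult_strict_left_mono) auto
    finally have Lh: "cmod (L j h) > 2 * \<bar>C\<bar>"
      using r nf by simp
    have "cmod (L j (x + h) - L j (x - h)) = 2 * cmod (L j h)"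
    proof -
      have "L j (x + h) = L j x + L j h"
        using Lj x h by (simp add: bounded_functional_def)
      with bounded_functional_diff[OF Lj x h] have "L j (x + h) - L j (x - h) = 2 * L j h"
        by simp
      then show ?thesis by (simp add: norm_mult)
    qed
    then have "cmod (L j (x + h)) > C \<or> cmod (L j (x - h)) > C"
      using norm_triangle_ineq4[of "L j (x + h)" "L j (x - h)"] Lh by linarith
    moreover have "nrm (x + h - x) \<le> r" "nrm (x - h - x) \<le> r"
      using nh hnorm_minus_commute[OF zero_mem h] by simp_all
    ultimately show ?thesis
      using x h j add_mem diff_mem by blast
  qed
  have step: "\<exists>x' r'. x' \<in> H \<and> r' > 0 \<and> r' \<le> r / 2 \<and> nrm (x' - x) \<le> r / 2 \<and>
      (\<exists>j\<in>J. \<forall>y\<in>H. nrm (y - x') \<le> r' \<longrightarrow> cmod (L j y) \<ge> C)"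
    if x: "x \<in> H" and r: "r > 0" for x r C
  proof -
    obtain x' j where x': "x' \<in> H" "nrm (x' - x) \<le> r / 2" and j: "j \<in> J"
      and big: "cmod (L j x') > C + 1"
      using large[OF x, of "r / 2" "C + 1"] r by auto
    obtain D where D: "D > 0" "\<And>f. f \<in> H \<Longrightarrow> cmod (L j f) \<le> D * nrm f"
      using bounded_functional_bound[OF L[OF j]] by blast
    \<comment> \<open>Within distance 1/D of the centre the values of \<open>L j\<close> vary by at
      most 1, which turns C + 1 at the centre into C on the whole ball.\<close>
    define r' where "r' = min (r / 2) (1 / D)"
    have "cmod (L j y) \<ge> C" if y: "y \<in> H" "nrm (y - x') \<le> r'" for y
    proof -
      have "cmod (L j y - L j x') \<le> D * nrm (y - x')"
        using D(2)[OF diff_mem[OF y(1) x'(1)]] bounded_functional_diff[OF L[OF j] y(1) x'(1)]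
        by simp
      also have "\<dots> \<le> D * (1 / D)"
        using y(2) D(1) by (intro mult_left_mono) (auto simp: r'_def)
      finally have "cmod (L j y - L j x') \<le> 1" using D(1) by simp
      then show ?thesis
        using big norm_triangle_ineq3[of "L j y" "L j x'"] by linarith
    qed
    then show ?thesis
      using x' j r D(1) by (intro exI[of _ x'] exI[of _ r']) (auto simp: r'_def)
  qed
  \<comment> \<open>States are pairs of a centre and a radius. \<open>Q\<close> places the next ball
    inside the current one and makes some \<open>L j\<close> at least n in modulus throughout it;
    halving the radii gives the bound (1/2)^n in \<open>P\<close>.\<close>
  define P where "P = (\<lambda>(n::nat) p. fst p \<in> H \<and> snd p > (0::real) \<and> snd p \<le> (1/2) ^ n)"
  define Q where "Q = (\<lambda>(n::nat) p q. snd q \<le> snd p / 2 \<and>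
      nrm (fst q - fst p) \<le> snd p / 2 \<and>
      (\<exists>j\<in>J. \<forall>y\<in>H. nrm (y - fst q) \<le> snd q \<longrightarrow> cmod (L j y) \<ge> real n))"
  have "\<exists>s. \<forall>n. P n (s n) \<and> Q n (s n) (s (Suc n))"
  proof (rule dependent_nat_choice)
    show "\<exists>p. P 0 p"
      using zero_mem by (intro exI[of _ "(0, 1)"]) (simp add: P_def)
    show "\<exists>q. P (Suc n) q \<and> Q n p q" if "P n p" for n p
    proof -
      have p: "fst p \<in> H" "snd p > 0" "snd p \<le> (1/2) ^ n" using that by (auto simp: P_def)
      obtain x' r' where "x' \<in> H \<and> r' > 0 \<and> r' \<le> snd p / 2 \<and> nrm (x' - fst p) \<le> snd p / 2 \<and>
          (\<exists>j\<in>J. \<forall>y\<in>H. nrm (y - x') \<le> r' \<longrightarrow> cmod (L j y) \<ge> real n)"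
        using step[OF p(1,2)] by blast
      then show ?thesis
        using p by (intro exI[of _ "(x', r')"]) (auto simp: P_def Q_def)
    qed
  qed
  then obtain s where s: "\<And>n. P n (s n)" "\<And>n. Q n (s n) (s (Suc n))" by blast
  define X where "X = (\<lambda>n. fst (s n))"
  define R where "R = (\<lambda>n. snd (s n))"
  have X: "X n \<in> H" and R: "R n > 0" "R n \<le> (1/2) ^ n" for n
    using s(1)[of n] by (auto simp: P_def X_def R_def)
  \<comment> \<open>Telescoping: since radii at least halve, the n-th displacement is at most R n /
    2 and hence at most R n - R (n + 1).\<close>
  have nest: "nrm (X (n + k) - X n) \<le> R n - R (n + k)" for n k
  proof (induction k)
    case 0
    show ?case by (simp only: add_0_right diff_self hnorm_zero order_refl)
  next
    case (Suc k)
    have "nrm (X (Suc (n + k)) - X (n + k)) \<le> R (n + k) / 2" "R (Suc (n + k)) \<le> R (n + k) / 2"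
      using s(2)[of "n + k"] by (auto simp: Q_def X_def R_def)
    with Suc.IH show ?case
      using hnorm_triangle_diff[OF X[of "Suc (n + k)"] X[of "n + k"] X[of n]]
      unfolding add_Suc_right by linarith
  qed
  have near: "nrm (X m - X n) \<le> R n" if "n \<le> m" for m n
    using nest[of n "m - n"] that R(1)[of m] by simp
  have "\<exists>f\<in>H. (\<lambda>n. nrm (X n - f)) \<longlonglongrightarrow> 0"
  proof (rule complete)
    fix e :: real assume e: "e > 0"
    obtain N where N: "(1/2::real) ^ N < e / 2"
      using e real_arch_pow_inv[of "e / 2" "1/2"] by auto
    have "nrm (X m - X n) < e" if "m \<ge> N" "n \<ge> N" for m n
      using hnorm_triangle_diff[OF X[of m] X[of N] X[of n]] near[OF that(1)] near[OF that(2)]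
        hnorm_minus_commute[OF X[of N] X[of n]] N R(2)[of N] by simp
    then show "\<exists>N. \<forall>m\<ge>N. \<forall>n\<ge>N. nrm (X m - X n) < e" by blast
  qed (rule X)
  then obtain f where f: "f \<in> H" and lim: "(\<lambda>n. nrm (X n - f)) \<longlonglongrightarrow> 0" by blast
  \<comment> \<open>Closed balls keep limits, so \<open>f\<close> lies in every one of them.\<close>
  have in_ball: "nrm (f - X n) \<le> R n" for n
  proof (rule tendsto_lowerbound)
    show "(\<lambda>m. nrm (X m - f) + R n) \<longlonglongrightarrow> R n"
      using tendsto_add[OF lim tendsto_const[of "R n"]] by simp
    show "\<forall>\<^sub>F m in sequentially. nrm (f - X n) \<le> nrm (X m - f) + R n"
      using eventually_ge_at_top[of n]
    proof eventually_elim
      case (elim m)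
      then show ?case
        using hnorm_triangle_diff[OF f X[of m] X[of n]] near[OF elim]
          hnorm_minus_commute[OF f X[of m]] by linarith
    qed
  qed simp
  obtain C where C: "\<And>j. j \<in> J \<Longrightarrow> cmod (L j f) \<le> C" using ptw[OF f] by blast
  obtain n where n: "real n > C" using reals_Archimedean2 by blast
  \<comment> \<open>Ball \<open>Suc n\<close> was built with threshold n, which exceeds the
    pointwise bound \<open>C\<close> at \<open>f\<close>.\<close>
  obtain j where "j \<in> J" "\<forall>y\<in>H. nrm (y - X (Suc n)) \<le> R (Suc n) \<longrightarrow> cmod (L j y) \<ge> real n"
    using s(2)[of n] by (auto simp: Q_def X_def R_def)
  then show False
    using in_ball[of "Suc n"] f C n by fastforce
qed

text \<open>The representing vector minimises \<open>\<parallel>f\<parallel>\<^sup>2 - 2 Re (L f)\<close>; minimising sequences are Cauchy by the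
  parallelogram law.\<close>

theorem Riesz_representation:
  assumes L: "bounded_functional L"
  shows "\<exists>k\<in>H. \<forall>f\<in>H. L f = ip f k"
proof -
  have L_add: "L (f + g) = L f + L g" if "f \<in> H" "g \<in> H" for f g
    using L that by (simp add: bounded_functional_def)
  have L_scale: "L (\<lambda>z. c * f z) = c * L f" if "f \<in> H" for c f
    using L that by (simp add: bounded_functional_def)
  obtain C where C: "C > 0" "\<And>f. f \<in> H \<Longrightarrow> cmod (L f) \<le> C * nrm f"
    using bounded_functional_bound[OF L] by blast
  define E where "E = (\<lambda>f. (nrm f)\<^sup>2 - 2 * Re (L f))"
  \<comment> \<open>Completing the square: t^2 - 2 C t >= - C^2 with t = ||f||.\<close>
  have "E f \<ge> - C\<^sup>2" if "f \<in> H" for f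
  proof -
    have "Re (L f) \<le> C * nrm f"
      using C(2)[OF that] complex_Re_le_cmod[of "L f"] by simp
    then show ?thesis
      using sum_squares_ge_zero[of "nrm f - C" 0]
      by (simp add: E_def power2_eq_square algebra_simps)
  qed
  then have bdd: "bdd_below (E ` H)" by (intro bdd_belowI[of _ "- C\<^sup>2"]) auto
  define m where "m = Inf (E ` H)"
  have m_le: "m \<le> E f" if "f \<in> H" for f
    using bdd that by (simp add: m_def cInf_lower)
  have "\<exists>f\<in>H. E f < m + inverse (real (Suc n))" for n
    using cInf_lessD[of "E ` H" "m + inverse (real (Suc n))"] zero_mem by (auto simp: m_def)
  then obtain X where X: "\<And>n. X n \<in> H" and EX: "\<And>n. E (X n) < m + inverse (real (Suc n))"
    by metis
  \<comment> \<open>With h the midpoint of f and g, the parallelogram law reads ||f - g||^2 = 2 E f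
    + 2 E g - 4 E h, and E h >= m.\<close>
  have par: "(nrm (f - g))\<^sup>2 \<le> 2 * (E f - m) + 2 * (E g - m)" if fg: "f \<in> H" "g \<in> H" for f g
  proof -
    define h where "h = (\<lambda>z. (1/2) * (f + g) z)"
    have h: "h \<in> H" using fg by (simp only: h_def scale_mem add_mem)
    have "nrm h = 1/2 * nrm (f + g)"
      using hnorm_scale[OF add_mem[OF fg], of "1/2"] by (simp add: h_def)
    moreover have "Re (L h) = 1/2 * (Re (L f) + Re (L g))"
    proof -
      have "L h = (1/2) * (L f + L g)"
        unfolding h_def L_scale[OF add_mem[OF fg]] L_add[OF fg] ..
      then show ?thesis by (simp only:) simp
    qed
    ultimately have "E h = (nrm (f + g))\<^sup>2 / 4 - Re (L f) - Re (L g)"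
      by (simp only: E_def power_mult_distrib) (simp add: power2_eq_square field_simps)
    moreover have "(nrm (f + g))\<^sup>2 + (nrm (f - g))\<^sup>2 = 2 * (nrm f)\<^sup>2 + 2 * (nrm g)\<^sup>2"
      using fg by (simp add: hnorm_square add_mem diff_mem ip_add ip_diff ip_add_right ip_diff_right)
    ultimately show ?thesis
      using m_le[OF h] by (simp add: E_def)
  qed
  have "\<exists>f\<in>H. (\<lambda>n. nrm (X n - f)) \<longlonglongrightarrow> 0"
  proof (rule complete)
    fix e :: real assume e: "e > 0"
    obtain N where N: "inverse (real (Suc N)) < e\<^sup>2 / 4"
      using reals_Archimedean[of "e\<^sup>2 / 4"] e by auto
    have small: "E (X i) - m < e\<^sup>2 / 4" if "i \<ge> N" for i
    proof -
      have "E (X i) - m < inverse (real (Suc i))" using EX[of i] by simp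
      also have "\<dots> \<le> inverse (real (Suc N))"
        using that by (intro le_imp_inverse_le) auto
      also note N
      finally show ?thesis .
    qed
    have "nrm (X i - X j) < e" if "i \<ge> N" "j \<ge> N" for i j
    proof -
      have "(nrm (X i - X j))\<^sup>2 < e\<^sup>2"
        using par[OF X[of i] X[of j]] small[OF that(1)] small[OF that(2)] by simp
      then show ?thesis using e by (simp add: power2_less_imp_less)
    qed
    then show "\<exists>N. \<forall>i\<ge>N. \<forall>j\<ge>N. nrm (X i - X j) < e" by blast
  qed (rule X)
  then obtain k where k: "k \<in> H" and lim: "(\<lambda>n. nrm (X n - k)) \<longlonglongrightarrow> 0" by blast
  have "(\<lambda>n. inverse (real (Suc n))) \<longlonglongrightarrow> 0" by (rule LIMSEQ_inverse_real_of_nat)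
  then have limE: "(\<lambda>n. m + inverse (real (Suc n))) \<longlonglongrightarrow> m"
    using tendsto_add[OF tendsto_const[of m]] by fastforce
  \<comment> \<open>First-order optimality along the minimising sequence: comparing
    \<open>E (X n + g)\<close> for g = t h with \<open>m\<close> and letting n tend to infinity
    gives 2 t a + t^2 b >= 0 for all real t, which forces a = 0.\<close>
  have Re_eq: "Re (L h) = Re (ip h k)" if h: "h \<in> H" for h
  proof -
    have "(\<lambda>n. ip h (X n)) \<longlonglongrightarrow> ip h k"
    proof (rule Lim_null[THEN iffD2], rule Lim_null_comparison)
      show "\<forall>\<^sub>F n in sequentially. cmod (ip h (X n) - ip h k) \<le> nrm h * nrm (X n - k)"
        using Cauchy_Schwarz[OF h diff_mem[OF X k]] by (simp add: ip_diff_right h X k)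
      show "(\<lambda>n. nrm h * nrm (X n - k)) \<longlonglongrightarrow> 0"
        using tendsto_mult_right_zero[OF lim] by simp
    qed
    then have limip: "(\<lambda>n. Re (ip h (X n))) \<longlonglongrightarrow> Re (ip h k)" by (rule tendsto_Re)
    define a where "a = Re (ip h k) - Re (L h)"
    define b where "b = (nrm h)\<^sup>2"
    have pos: "0 \<le> 2 * t * a + t\<^sup>2 * b" for t :: real
    proof -
      have "m \<le> (m + inverse (real (Suc n))) + 2 * t * (Re (ip h (X n)) - Re (L h)) + t\<^sup>2 * b" for n
      proof -
        define g where "g = (\<lambda>z. complex_of_real t * h z)"
        have g: "g \<in> H" using h by (simp add: g_def scale_mem)
        have "(nrm (X n + g))\<^sup>2 = (nrm (X n))\<^sup>2 + 2 * t * Re (ip h (X n)) + t\<^sup>2 * b"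
          using hnorm_add_square[OF X[of n] g] ip_commute[OF X[of n] h] hnorm_scale[OF h, of "of_real t"]
            X[of n] h by (simp add: g_def ip_scale_right b_def power_mult_distrib)
        moreover have "L (X n + g) = L (X n) + of_real t * L h"
          using L_add[OF X g] L_scale[OF h] by (simp add: g_def)
        ultimately have "E (X n + g) = E (X n) + 2 * t * (Re (ip h (X n)) - Re (L h)) + t\<^sup>2 * b"
          by (simp add: E_def algebra_simps)
        then show ?thesis
          using m_le[OF add_mem[OF X[of n] g]] EX[of n] by simp
      qed
      moreover have "(\<lambda>n. (m + inverse (real (Suc n))) + 2 * t * (Re (ip h (X n)) - Re (L h)) + t\<^sup>2 * b)
          \<longlonglongrightarrow> m + 2 * t * a + t\<^sup>2 * b"
        unfolding a_def by (intro tendsto_intros limE limip)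
      ultimately have "m \<le> m + 2 * t * a + t\<^sup>2 * b"
        by (intro tendsto_lowerbound[of _ _ sequentially]) auto
      then show ?thesis by simp
    qed
    have "a = 0"
    proof (rule ccontr)
      assume "a \<noteq> 0"
      have b: "b \<ge> 0" by (simp add: b_def)
      \<comment> \<open>The choice t = - a / (b + 1) plays the part of the minimiser - a / b and
        stays defined for b = 0.\<close>
      have "2 * (- a / (b + 1)) * a + (- a / (b + 1))\<^sup>2 * b = - (a\<^sup>2 * (b + 2)) / (b + 1)\<^sup>2"
        using b by (simp add: divide_simps power2_eq_square) algebra
      also have "\<dots> < 0" using b \<open>a \<noteq> 0\<close> by (intro divide_neg_pos) (auto intro!: mult_pos_pos)
      finally show False using pos[of "- a / (b + 1)"] by simp
    qed
    then show ?thesis by (simp add: a_def)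
  qed
  have "L h = ip h k" if h: "h \<in> H" for h
  proof (rule complex_eqI)
    \<comment> \<open>Equality of real parts at \<i> h gives equality of imaginary parts at h, as Re
      (\<i> z) = - Im z.\<close>
    show "Im (L h) = Im (ip h k)"
      using Re_eq[OF scale_mem[OF h, of \<i>]] L_scale[OF h, of \<i>] ip_scale[OF h k, of \<i>] by simp
  qed (rule Re_eq[OF h])
  with k show ?thesis by blast
qed

section \<open>Operators\<close>

lemma bounded_operator_bound:
  assumes "bounded_operator H ip A"
  obtains C where "C \<ge> 0" "\<And>f. f \<in> H \<Longrightarrow> nrm (A f) \<le> C * nrm f"
proof -
  obtain C where C: "\<forall>f\<in>H. nrm (A f) \<le> C * nrm f"
    using assms by (auto simp: bounded_operator_def)
  have "nrm (A f) \<le> \<bar>C\<bar> * nrm f" if "f \<in> H" for f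
    using C that hnorm_nonneg[OF that] by (smt (verit) mult_right_mono)
  then show ?thesis using that[of "\<bar>C\<bar>"] by simp
qed

lemma bounded_operator_mem: "bounded_operator H ip A \<Longrightarrow> f \<in> H \<Longrightarrow> A f \<in> H"
  by (auto simp: bounded_operator_def)

lemma bounded_operator_compose:
  assumes A: "bounded_operator H ip A" and B: "bounded_operator H ip B"
  shows "bounded_operator H ip (\<lambda>f. A (B f))"
proof -
  obtain C D where C: "C \<ge> 0" "\<And>f. f \<in> H \<Longrightarrow> nrm (A f) \<le> C * nrm f"
    and D: "D \<ge> 0" "\<And>f. f \<in> H \<Longrightarrow> nrm (B f) \<le> D * nrm f"
    using bounded_operator_bound[OF A] bounded_operator_bound[OF B] by metis
  have "nrm (A (B f)) \<le> (C * D) * nrm f" if "f \<in> H" for f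
    using C(2)[OF bounded_operator_mem[OF B that]] mult_left_mono[OF D(2)[OF that] C(1)]
    by (simp add: mult.assoc)
  moreover have "A (B f) \<in> H" if "f \<in> H" for f
    using that A B bounded_operator_mem by blast
  ultimately show ?thesis
    using A B unfolding bounded_operator_def by (auto simp: Pi_iff)
qed

text \<open>By Cauchy-Schwarz the map sending f to <A f, g> is a bounded functional, and its Riesz
  vector is the value of the adjoint at g. Uniqueness of that vector makes the description in
  \<open>hadjoint\<close> meaningful.\<close>

lemma hadjoint:
  assumes A: "bounded_operator H ip A" and g: "g \<in> H"
  shows hadjoint_mem: "hadjoint H ip A g \<in> H"
    and ip_hadjoint: "\<And>f. f \<in> H \<Longrightarrow> ip (A f) g = ip f (hadjoint H ip A g)"
proof -
  obtain C where C: "C \<ge> 0" "\<And>f. f \<in> H \<Longrightarrow> nrm (A f) \<le> C * nrm f"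
    using bounded_operator_bound[OF A] by blast
  have "cmod (ip (A f) g) \<le> (C * nrm g) * nrm f" if "f \<in> H" for f
    using Cauchy_Schwarz[OF bounded_operator_mem[OF A that] g]
      mult_right_mono[OF C(2)[OF that] hnorm_nonneg[OF g]] by (simp add: mult_ac)
  then have "bounded_functional (\<lambda>f. ip (A f) g)"
    using A g unfolding bounded_functional_def bounded_operator_def
    by (auto simp: ip_add ip_scale Pi_iff)
  then obtain h where h: "h \<in> H" "\<forall>f\<in>H. ip (A f) g = ip f h"
    using Riesz_representation by blast
  have "hadjoint H ip A g \<in> H \<and> (\<forall>f\<in>H. ip (A f) g = ip f (hadjoint H ip A g))"
    unfolding hadjoint_def
    by (rule theI[of _ h]) (use h ip_right_eqI in auto)
  then show "hadjoint H ip A g \<in> H" "\<And>f. f \<in> H \<Longrightarrow> ip (A f) g = ip f (hadjoint H ip A g)"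
    by auto
qed

section \<open>Invertible operators\<close>

lemma GL_bounded_operator: "A \<in> GL H ip \<Longrightarrow> bounded_operator H ip A"
  by (simp add: GL_def)

lemma GL_inverse:
  assumes "A \<in> GL H ip"
  obtains B where "B \<in> GL H ip" "\<And>f. f \<in> H \<Longrightarrow> B (A f) = f" "\<And>f. f \<in> H \<Longrightarrow> A (B f) = f"
  using assms unfolding GL_def by blast

text \<open>Composing A S = 1 with the inverse B of A gives S = B on \<open>H\<close>, so S inverts
  A on both sides. This is how S A = 1 is obtained once a kernel expansion has given A S =
  1.\<close>

lemma GL_left_inverse_imp_right_inverse:
  assumes A: "A \<in> GL H ip" and S: "S \<in> H \<rightarrow> H" and AS: "\<And>f. f \<in> H \<Longrightarrow> A (S f) = f"
    and f: "f \<in> H"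
  shows "S (A f) = f"
proof -
  obtain B where "\<And>f. f \<in> H \<Longrightarrow> B (A f) = f" using GL_inverse[OF A] by metis
  then show ?thesis
    using AS S f bounded_operator_mem[OF GL_bounded_operator[OF A] f] by (metis funcset_mem)
qed

text \<open>Uniform boundedness is applied to the finite partial sums, first as functionals of g for
  fixed f, then as functionals of f, uniformly over all partial sums and all g in the unit ball. The
  resulting joint bound does not depend on the partial sum and passes to the limit.\<close>

lemma bounded_form_of_pointwise_summable:
  assumes \<psi>: "\<And>i. i \<in> I \<Longrightarrow> \<psi> i \<in> H" and \<phi>: "\<And>i. i \<in> I \<Longrightarrow> \<phi> i \<in> H"
    and conv: "frame_series_converge H ip I \<psi> \<phi>"
  shows "\<exists>C. \<forall>f\<in>H. \<forall>g\<in>H. cmod (\<Sum>\<^sub>\<infinity>i\<in>I. ip f (\<psi> i) * ip (\<phi> i) g) \<le> C * nrm f * nrm g"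
proof -
  define B where "B = (\<lambda>F f g. \<Sum>i\<in>F. ip f (\<psi> i) * ip (\<phi> i) g)"
  define \<F> where "\<F> = {F. finite F \<and> F \<subseteq> I}"
  \<comment> \<open>This constant depends on \<open>F\<close>; it makes each single partial sum a
    bounded functional in either variable, as uniform boundedness requires.\<close>
  have B_bound: "\<exists>C\<ge>0. \<forall>f\<in>H. \<forall>g\<in>H. cmod (B F f g) \<le> C * nrm f * nrm g" if F: "F \<in> \<F>" for F
  proof (intro exI conjI ballI)
    have inI: "i \<in> I" if "i \<in> F" for i using F that by (auto simp: \<F>_def)
    show "0 \<le> (\<Sum>i\<in>F. nrm (\<psi> i) * nrm (\<phi> i))"
      using inI \<psi> \<phi> by (intro sum_nonneg mult_nonneg_nonneg hnorm_nonneg) auto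
    fix f g assume fg: "f \<in> H" "g \<in> H"
    have "cmod (B F f g) \<le> (\<Sum>i\<in>F. (nrm f * nrm (\<psi> i)) * (nrm (\<phi> i) * nrm g))"
      unfolding B_def using inI \<psi> \<phi> fg
      by (intro sum_norm_le) (auto simp: norm_mult intro!: mult_mono Cauchy_Schwarz mult_nonneg_nonneg hnorm_nonneg)
    also have "\<dots> = (\<Sum>i\<in>F. nrm (\<psi> i) * nrm (\<phi> i)) * nrm f * nrm g"
      by (simp add: sum_distrib_right sum_distrib_left mult_ac)
    finally show "cmod (B F f g) \<le> (\<Sum>i\<in>F. nrm (\<psi> i) * nrm (\<phi> i)) * nrm f * nrm g" .
  qed
  have mem: "\<psi> i \<in> H" "\<phi> i \<in> H" if "F \<in> \<F>" "i \<in> F" for F i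
    using that \<psi> \<phi> by (auto simp: \<F>_def)
  \<comment> \<open>Unordered summability of complex terms is absolute, so the sum of the moduli
    bounds all finite partial sums at once.\<close>
  have ptw: "\<exists>C. \<forall>F\<in>\<F>. cmod (B F f g) \<le> C" if fg: "f \<in> H" "g \<in> H" for f g
  proof -
    have "(\<lambda>i. ip f (\<psi> i) * ip (\<phi> i) g) summable_on I"
      using conv fg by (simp add: frame_series_converge_def)
    then have *: "(\<lambda>i. cmod (ip f (\<psi> i) * ip (\<phi> i) g)) summable_on I"
      by (simp add: summable_on_iff_abs_summable_on_complex)
    have "cmod (B F f g) \<le> (\<Sum>\<^sub>\<infinity>i\<in>I. cmod (ip f (\<psi> i) * ip (\<phi> i) g))" if "F \<in> \<F>" for F
    proof -
      have "cmod (B F f g) \<le> (\<Sum>i\<in>F. cmod (ip f (\<psi> i) * ip (\<phi> i) g))"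
        unfolding B_def by (rule norm_sum)
      also have "\<dots> \<le> (\<Sum>\<^sub>\<infinity>i\<in>I. cmod (ip f (\<psi> i) * ip (\<phi> i) g))"
        using that * by (intro finite_sum_le_infsum) (auto simp: \<F>_def)
      finally show ?thesis .
    qed
    then show ?thesis by blast
  qed
  have ptw': "\<exists>C. \<forall>F\<in>\<F>. \<forall>g\<in>H. cmod (B F f g) \<le> C * nrm g" if f: "f \<in> H" for f
  proof -
    \<comment> \<open>The form is conjugate-linear in g; \<open>cnj\<close> turns it into a linear
      functional.\<close>
    have lin: "bounded_functional (\<lambda>g. cnj (B F f g))" if F: "F \<in> \<F>" for F
    proof -
      obtain C where "\<forall>f\<in>H. \<forall>g\<in>H. cmod (B F f g) \<le> C * nrm f * nrm g" using B_bound[OF F] by blast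
      then have "\<forall>g\<in>H. cmod (cnj (B F f g)) \<le> (C * nrm f) * nrm g" using f by auto
      moreover have "cnj (B F f (g + h)) = cnj (B F f g) + cnj (B F f h)" if "g \<in> H" "h \<in> H" for g h
        using that mem[OF F] by (simp add: B_def ip_add_right algebra_simps sum.distrib)
      moreover have "cnj (B F f (\<lambda>z. c * g z)) = c * cnj (B F f g)" if "g \<in> H" for c g
        using that mem[OF F] by (simp add: B_def ip_scale_right sum_distrib_left mult_ac)
      ultimately show ?thesis unfolding bounded_functional_def by blast
    qed
    have "\<exists>C. \<forall>F\<in>\<F>. \<forall>g\<in>H. cmod (cnj (B F f g)) \<le> C * nrm g"
      by (rule uniform_boundedness) (use lin ptw[OF f] in auto)
    then show ?thesis by simp
  qed
  define U where "U = {g \<in> H. nrm g \<le> 1}"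
  \<comment> \<open>Second application: the index is now a pair (F, g) with ||g|| <= 1, and
    boundedness at each f is \<open>ptw'\<close> restricted to the unit ball.\<close>
  have "\<exists>C. \<forall>p\<in>\<F> \<times> U. \<forall>f\<in>H. cmod (B (fst p) f (snd p)) \<le> C * nrm f"
  proof (rule uniform_boundedness)
    fix p assume p: "p \<in> \<F> \<times> U"
    then have F: "fst p \<in> \<F>" and g: "snd p \<in> H" by (auto simp: U_def)
    obtain C where "\<forall>f\<in>H. \<forall>g\<in>H. cmod (B (fst p) f g) \<le> C * nrm f * nrm g"
      using B_bound[OF F] by blast
    then have "\<forall>f\<in>H. cmod (B (fst p) f (snd p)) \<le> (C * nrm (snd p)) * nrm f"
      using g by (auto simp: mult_ac)
    moreover have "B (fst p) (f + h) (snd p) = B (fst p) f (snd p) + B (fst p) h (snd p)"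
      if "f \<in> H" "h \<in> H" for f h
      using that mem[OF F] by (simp add: B_def ip_add algebra_simps sum.distrib)
    moreover have "B (fst p) (\<lambda>z. c * f z) (snd p) = c * B (fst p) f (snd p)" if "f \<in> H" for c f
      using that mem[OF F] by (simp add: B_def ip_scale sum_distrib_left mult_ac)
    ultimately show "bounded_functional (\<lambda>f. B (fst p) f (snd p))"
      unfolding bounded_functional_def by blast
  next
    fix f assume f: "f \<in> H"
    obtain C where C: "\<forall>F\<in>\<F>. \<forall>g\<in>H. cmod (B F f g) \<le> C * nrm g" using ptw'[OF f] by blast
    have "cmod (B F f g) \<le> \<bar>C\<bar>" if "F \<in> \<F>" "g \<in> U" for F g
    proof -
      have g: "g \<in> H" "nrm g \<le> 1" using that by (auto simp: U_def)
      have "cmod (B F f g) \<le> \<bar>C\<bar> * nrm g"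
        using C that(1) g(1) hnorm_nonneg[OF g(1)] by (smt (verit) mult_right_mono)
      also have "\<dots> \<le> \<bar>C\<bar>" using g by (simp add: mult_left_le)
      finally show ?thesis .
    qed
    then show "\<exists>C. \<forall>p\<in>\<F> \<times> U. cmod (B (fst p) f (snd p)) \<le> C" by auto
  qed
  then obtain C where C: "\<And>F g f. F \<in> \<F> \<Longrightarrow> g \<in> U \<Longrightarrow> f \<in> H \<Longrightarrow> cmod (B F f g) \<le> C * nrm f"
    by force
  \<comment> \<open>Homogeneity: g is rescaled to the unit vector \<open>u\<close>, which is why g =
    0 is treated separately.\<close>
  have fin: "cmod (B F f g) \<le> C * nrm f * nrm g" if F: "F \<in> \<F>" and fg: "f \<in> H" "g \<in> H" for F f g
  proof (cases "g = 0")
    case True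
    then show ?thesis using mem[OF F] by (simp add: B_def ip_zero_right hnorm_zero)
  next
    case False
    then have ng: "nrm g > 0"
      using fg hnorm_eq_0_iff hnorm_nonneg by (metis less_eq_real_def)
    define c where "c = complex_of_real (1 / nrm g)"
    have c: "cmod c = 1 / nrm g" using ng by (simp add: c_def norm_divide)
    define u where "u = (\<lambda>z. c * g z)"
    have "nrm u = 1" using fg ng by (simp add: u_def hnorm_scale c)
    then have u: "u \<in> U" using fg by (simp add: U_def u_def scale_mem)
    have "B F f u = cnj c * B F f g"
      using fg mem[OF F] by (simp add: B_def u_def ip_scale_right sum_distrib_left mult_ac)
    then have "cmod (B F f g) = cmod (B F f u) * nrm g"
      using ng by (simp add: norm_mult c)
    also have "\<dots> \<le> C * nrm f * nrm g"
      using C[OF F u fg(1)] ng by (intro mult_right_mono) auto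
    finally show ?thesis .
  qed
  have "cmod (\<Sum>\<^sub>\<infinity>i\<in>I. ip f (\<psi> i) * ip (\<phi> i) g) \<le> C * nrm f * nrm g" if fg: "f \<in> H" "g \<in> H" for f g
  proof -
    have "((\<lambda>i. ip f (\<psi> i) * ip (\<phi> i) g) has_sum (\<Sum>\<^sub>\<infinity>i\<in>I. ip f (\<psi> i) * ip (\<phi> i) g)) I"
      using conv fg by (simp add: frame_series_converge_def)
    then have "((\<lambda>F. cmod (B F f g)) \<longlongrightarrow> cmod (\<Sum>\<^sub>\<infinity>i\<in>I. ip f (\<psi> i) * ip (\<phi> i) g))
        (finite_subsets_at_top I)"
      unfolding has_sum_def B_def by (rule tendsto_norm)
    then show ?thesis
      by (rule tendsto_upperbound)
        (auto intro!: eventually_finite_subsets_at_top_weakI fin fg simp: \<F>_def)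
  qed
  then show ?thesis by blast
qed

section \<open>The weakly defined frame operator\<close>

lemma frame_operator_eqI:
  assumes "h \<in> H" "\<And>g. g \<in> H \<Longrightarrow> ((\<lambda>i. ip f (\<psi> i) * ip (\<phi> i) g) has_sum ip h g) I"
  shows "frame_operator H ip I \<psi> \<phi> f = h"
  unfolding frame_operator_def
proof (rule the_equality)
  show "k = h" if "k \<in> H \<and> (\<forall>g\<in>H. ((\<lambda>i. ip f (\<psi> i) * ip (\<phi> i) g) has_sum ip k g) I)" for k
    using that assms by (intro ip_left_eqI) (auto intro: has_sum_unique)
qed (use assms in auto)

text \<open>For fixed f the sum \<open>B f g\<close> is conjugate-linear and bounded in g, so Riesz
  applied to its conjugate yields h with <h, g> = \<open>B f g\<close>, and by uniqueness h is the
  image of f. Linearity follows from the same uniqueness: the combination of the images satisfies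
  the weak identity of the combined argument.\<close>

lemma frame_operator:
  assumes \<psi>: "\<And>i. i \<in> I \<Longrightarrow> \<psi> i \<in> H" and \<phi>: "\<And>i. i \<in> I \<Longrightarrow> \<phi> i \<in> H"
    and conv: "frame_series_converge H ip I \<psi> \<phi>"
  shows bounded_operator_frame_operator: "bounded_operator H ip (frame_operator H ip I \<psi> \<phi>)"
    and has_sum_frame_operator: "\<And>f g. f \<in> H \<Longrightarrow> g \<in> H \<Longrightarrow>
      ((\<lambda>i. ip f (\<psi> i) * ip (\<phi> i) g) has_sum ip (frame_operator H ip I \<psi> \<phi> f) g) I"
proof -
  let ?S = "frame_operator H ip I \<psi> \<phi>"
  define B where "B = (\<lambda>f g. \<Sum>\<^sub>\<infinity>i\<in>I. ip f (\<psi> i) * ip (\<phi> i) g)"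
  have B: "((\<lambda>i. ip f (\<psi> i) * ip (\<phi> i) g) has_sum B f g) I" if "f \<in> H" "g \<in> H" for f g
    using conv that by (simp add: frame_series_converge_def B_def)
  obtain C where C: "\<And>f g. f \<in> H \<Longrightarrow> g \<in> H \<Longrightarrow> cmod (B f g) \<le> C * nrm f * nrm g"
    using bounded_form_of_pointwise_summable[OF \<psi> \<phi> conv] by (auto simp: B_def)
  have S: "?S f \<in> H \<and> (\<forall>g\<in>H. ip (?S f) g = B f g)" if f: "f \<in> H" for f
  proof -
    have "cnj (B f (g + h)) = cnj (B f g) + cnj (B f h)" if gh: "g \<in> H" "h \<in> H" for g h
    proof -
      have "((\<lambda>i. ip f (\<psi> i) * ip (\<phi> i) (g + h)) has_sum B f g + B f h) I"
        using has_sum_add[OF B[OF f gh(1)] B[OF f gh(2)]]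
        by (rule has_sum_cong[THEN iffD1, rotated])
          (use gh \<phi> in \<open>auto simp: ip_add_right algebra_simps\<close>)
      then show ?thesis using B[OF f add_mem[OF gh]] has_sum_unique by fastforce
    qed
    moreover have "cnj (B f (\<lambda>z. c * g z)) = c * cnj (B f g)" if g: "g \<in> H" for c g
    proof -
      have "((\<lambda>i. ip f (\<psi> i) * ip (\<phi> i) (\<lambda>z. c * g z)) has_sum cnj c * B f g) I"
        using has_sum_cmult_right[OF B[OF f g], of "cnj c"]
        by (rule has_sum_cong[THEN iffD1, rotated])
          (use g \<phi> in \<open>auto simp: ip_scale_right algebra_simps\<close>)
      then show ?thesis using B[OF f scale_mem[OF g]] has_sum_unique by fastforce
    qed
    moreover have "\<forall>g\<in>H. cmod (cnj (B f g)) \<le> (C * nrm f) * nrm g" using C f by simp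
    ultimately have "bounded_functional (\<lambda>g. cnj (B f g))"
      unfolding bounded_functional_def by blast
    then obtain h where h: "h \<in> H" "\<forall>g\<in>H. cnj (B f g) = ip g h"
      using Riesz_representation by blast
    then have hB: "\<forall>g\<in>H. ip h g = B f g" by (metis complex_cnj_cnj ip_commute)
    have "?S f = h"
      by (rule frame_operator_eqI) (use h hB B f in auto)
    with h hB show ?thesis by simp
  qed
  then show sum: "((\<lambda>i. ip f (\<psi> i) * ip (\<phi> i) g) has_sum ip (?S f) g) I" if "f \<in> H" "g \<in> H" for f g
    using B that by simp
  show "bounded_operator H ip ?S"
    unfolding bounded_operator_def
  proof (intro conjI ballI allI exI)
    show "?S \<in> H \<rightarrow> H" using S by auto
    show "?S (f + g) = ?S f + ?S g" if fg: "f \<in> H" "g \<in> H" for f g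
    proof (rule frame_operator_eqI)
      show "((\<lambda>i. ip (f + g) (\<psi> i) * ip (\<phi> i) h) has_sum ip (?S f + ?S g) h) I" if h: "h \<in> H" for h
      proof -
        have "((\<lambda>i. ip f (\<psi> i) * ip (\<phi> i) h + ip g (\<psi> i) * ip (\<phi> i) h) has_sum ip (?S f + ?S g) h) I"
          using has_sum_add[OF sum[OF fg(1) h] sum[OF fg(2) h]] S fg h by (simp add: ip_add)
        then show ?thesis
          by (rule has_sum_cong[THEN iffD1, rotated])
            (use fg h \<psi> in \<open>auto simp: ip_add algebra_simps\<close>)
      qed
    qed (use S fg add_mem in auto)
    show "?S (\<lambda>z. c * f z) = (\<lambda>z. c * ?S f z)" if f: "f \<in> H" for c f
    proof (rule frame_operator_eqI)
      show "((\<lambda>i. ip (\<lambda>z. c * f z) (\<psi> i) * ip (\<phi> i) h) has_sum ip (\<lambda>z. c * ?S f z) h) I"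
        if h: "h \<in> H" for h
      proof -
        have "((\<lambda>i. c * (ip f (\<psi> i) * ip (\<phi> i) h)) has_sum ip (\<lambda>z. c * ?S f z) h) I"
          using has_sum_cmult_right[OF sum[OF f h], of c] S f h by (simp add: ip_scale)
        then show ?thesis
          by (rule has_sum_cong[THEN iffD1, rotated])
            (use f h \<psi> in \<open>auto simp: ip_scale algebra_simps\<close>)
      qed
    qed (use S f scale_mem in auto)
    show "nrm (?S f) \<le> \<bar>C\<bar> * nrm f" if f: "f \<in> H" for f
    proof -
      have Sf: "?S f \<in> H" using S f by blast
      \<comment> \<open>Testing with g = S f gives ||S f||^2 <= C ||f|| ||S f||, and a nonzero ||S
        f|| cancels. The sign of \<open>C\<close> is not known, so |C| covers the case ||S f|| =
        0.\<close>
      have "nrm (?S f) * nrm (?S f) = cmod (ip (?S f) (?S f))"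
        using Sf by (simp add: ip_self norm_power power2_eq_square norm_mult)
      also have "\<dots> \<le> C * nrm f * nrm (?S f)"
        using C[OF f Sf] S f Sf by simp
      finally have "nrm (?S f) * nrm (?S f) \<le> C * nrm f * nrm (?S f)" .
      then have "nrm (?S f) \<le> C * nrm f \<or> nrm (?S f) = 0"
        using hnorm_nonneg[OF Sf] by (metis less_eq_real_def mult_le_cancel_right_pos)
      moreover have "C * nrm f \<le> \<bar>C\<bar> * nrm f" "0 \<le> \<bar>C\<bar> * nrm f"
        using hnorm_nonneg[OF f] by (auto intro: mult_right_mono)
      ultimately show ?thesis by linarith
    qed
  qed
qed

end

section \<open>Reproducing kernels\<close>

context rkhs
begin

text \<open>Point evaluation at \<open>w\<close> is linear and, in an RKHS, bounded; its Riesz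
  vector is k_w.\<close>

lemma kernel_fun:
  shows kernel_fun_mem: "kernel_fun H ip w \<in> H"
    and ip_kernel_fun: "\<And>f. f \<in> H \<Longrightarrow> ip f (kernel_fun H ip w) = f w"
proof -
  have "bounded_functional (\<lambda>f. f w)"
    unfolding bounded_functional_def using bounded_eval by simp
  then obtain k where k: "k \<in> H" "\<forall>f\<in>H. f w = ip f k"
    using Riesz_representation by blast
  have "kernel_fun H ip w \<in> H \<and> (\<forall>f\<in>H. f w = ip f (kernel_fun H ip w))"
    unfolding kernel_fun_def
    by (rule theI[of _ k]) (use k ip_right_eqI in auto)
  then show "kernel_fun H ip w \<in> H" "\<And>f. f \<in> H \<Longrightarrow> ip f (kernel_fun H ip w) = f w"
    by auto
qed

lemma kernel_fun_ip: "f \<in> H \<Longrightarrow> ip (kernel_fun H ip w) f = cnj (f w)"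
  using ip_commute[OF _ kernel_fun_mem] ip_kernel_fun by simp

text \<open>For g in \<open>H\<close> and every w, <k_w, T* g> = <T k_w, g> = <k_w, g>, that is, (T*
  g)(w) = g(w). So T* is the identity, and therefore T is.\<close>

lemma bounded_operator_eq_id_of_fixes_kernel:
  assumes T: "bounded_operator H ip T"
    and fixed: "\<And>w. T (kernel_fun H ip w) = kernel_fun H ip w" and f: "f \<in> H"
  shows "T f = f"
proof (rule ip_left_eqI)
  fix g assume g: "g \<in> H"
  have "cnj (hadjoint H ip T g w) = cnj (g w)" for w
    using ip_hadjoint[OF T g kernel_fun_mem[of w]] hadjoint_mem[OF T g] g
    by (simp add: fixed kernel_fun_ip)
  then have "hadjoint H ip T g = g" by (intro ext) simp
  then show "ip (T f) g = ip f g" using ip_hadjoint[OF T g f] by simp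
qed (use T f bounded_operator_mem in auto)

section \<open>The frame operator tested against kernel functions\<close>

context
  fixes I :: "'i set" and \<psi> \<phi> :: "'i \<Rightarrow> 'z \<Rightarrow> complex"
  assumes \<psi>: "\<And>i. i \<in> I \<Longrightarrow> \<psi> i \<in> H" and \<phi>: "\<And>i. i \<in> I \<Longrightarrow> \<phi> i \<in> H"
    and conv: "frame_series_converge H ip I \<psi> \<phi>"
begin

abbreviation "S \<equiv> frame_operator H ip I \<psi> \<phi>"

lemma S_mem: "f \<in> H \<Longrightarrow> S f \<in> H"
  using bounded_operator_frame_operator[OF \<psi> \<phi> conv] bounded_operator_mem by blast

text \<open>This is the weak identity for \<open>S\<close> at f = k_w and g = A* k_z, where moving
  A* back across the inner product turns the second factor of each term into a value of
  \<open>A (\<phi> i)\<close>.\<close>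

lemma has_sum_operator_kernel:
  assumes A: "bounded_operator H ip A"
  shows "((\<lambda>i. A (\<phi> i) z * cnj (\<psi> i w)) has_sum A (S (kernel_fun H ip w)) z) I"
proof -
  let ?k = "kernel_fun H ip"
  let ?a = "hadjoint H ip A (?k z)"
  have eq: "ip (S (?k w)) ?a = A (S (?k w)) z"
    using ip_hadjoint[OF A kernel_fun_mem S_mem[OF kernel_fun_mem]]
    by (simp add: ip_kernel_fun bounded_operator_mem[OF A] S_mem kernel_fun_mem)
  have "((\<lambda>i. ip (?k w) (\<psi> i) * ip (\<phi> i) ?a) has_sum A (S (?k w)) z) I"
    unfolding eq[symmetric]
    by (rule has_sum_frame_operator[OF \<psi> \<phi> conv kernel_fun_mem hadjoint_mem[OF A kernel_fun_mem]])
  then show ?thesis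
  proof (rule has_sum_cong[THEN iffD1, rotated])
    fix i assume i: "i \<in> I"
    show "ip (?k w) (\<psi> i) * ip (\<phi> i) ?a = A (\<phi> i) z * cnj (\<psi> i w)"
      using ip_hadjoint[OF A kernel_fun_mem \<phi>[OF i]]
      by (simp add: kernel_fun_ip \<psi> \<phi> i ip_kernel_fun bounded_operator_mem[OF A])
  qed
qed

text \<open>Here the weak identity is taken at f = A k_z and g = k_w and then conjugated, which
  turns <A k_z, \<psi> i> = <k_z, A* \<psi> i> into the value of A* \<psi> i at z.\<close>

lemma has_sum_adjoint_kernel:
  assumes A: "bounded_operator H ip A"
  shows "((\<lambda>i. hadjoint H ip A (\<psi> i) z * cnj (\<phi> i w)) has_sum
    cnj (S (A (kernel_fun H ip z)) w)) I"
proof -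
  let ?k = "kernel_fun H ip"
  have Ak: "A (?k z) \<in> H" using A bounded_operator_mem kernel_fun_mem by blast
  have "((\<lambda>i. ip (A (?k z)) (\<psi> i) * ip (\<phi> i) (?k w)) has_sum S (A (?k z)) w) I"
    using has_sum_frame_operator[OF \<psi> \<phi> conv Ak kernel_fun_mem[of w]]
    by (simp add: ip_kernel_fun S_mem Ak)
  then have "((\<lambda>i. cnj (ip (A (?k z)) (\<psi> i) * ip (\<phi> i) (?k w))) has_sum cnj (S (A (?k z)) w)) I"
    by (simp only: has_sum_cnj_iff)
  then show ?thesis
  proof (rule has_sum_cong[THEN iffD1, rotated])
    fix i assume i: "i \<in> I"
    show "cnj (ip (A (?k z)) (\<psi> i) * ip (\<phi> i) (?k w)) = hadjoint H ip A (\<psi> i) z * cnj (\<phi> i w)"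
      using ip_hadjoint[OF A \<psi>[OF i] kernel_fun_mem] hadjoint_mem[OF A \<psi>[OF i]]
      by (simp add: kernel_fun_ip \<phi> i ip_kernel_fun)
  qed
qed

section \<open>Kernel expansions and inverses of the frame operator\<close>

lemma kernel_expansion_of_inverse:
  assumes A: "bounded_operator H ip A"
    and AS: "\<And>f. f \<in> H \<Longrightarrow> A (S f) = f" and SA: "\<And>f. f \<in> H \<Longrightarrow> S (A f) = f"
  shows "kernel_expansion H ip I \<psi> \<phi> A"
proof -
  \<comment> \<open>Hermitian symmetry of the kernel: once S A = 1, the second series has the value
    cnj (k_z(w)), which has to be identified with K(z, w) = k_w(z).\<close>
  have "cnj (kernel_fun H ip z w) = kernel_fun H ip w z" for z w
    using kernel_fun_ip[OF kernel_fun_mem] ip_kernel_fun[OF kernel_fun_mem] by metis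
  then show ?thesis
    using has_sum_operator_kernel[OF A] has_sum_adjoint_kernel[OF A]
    by (simp add: kernel_expansion_def repr_kernel_def AS SA kernel_fun_mem)
qed

text \<open>The series for (A S k_w)(z) also sums to K(z, w), and sums are unique. So A S fixes
  every kernel function and, being bounded, is the identity.\<close>

lemma kernel_expansion_imp_left_inverse:
  assumes A: "bounded_operator H ip A" and exp: "kernel_expansion H ip I \<psi> \<phi> A" and f: "f \<in> H"
  shows "A (S f) = f"
proof (rule bounded_operator_eq_id_of_fixes_kernel[OF _ _ f])
  show "bounded_operator H ip (\<lambda>f. A (S f))"
    by (rule bounded_operator_compose[OF A bounded_operator_frame_operator[OF \<psi> \<phi> conv]])
  show "A (S (kernel_fun H ip w)) = kernel_fun H ip w" for w
  proof
    fix z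
    have "((\<lambda>i. A (\<phi> i) z * cnj (\<psi> i w)) has_sum kernel_fun H ip w z) I"
      using exp by (simp add: kernel_expansion_def repr_kernel_def)
    with has_sum_operator_kernel[OF A] show "A (S (kernel_fun H ip w)) z = kernel_fun H ip w z"
      by (rule has_sum_unique)
  qed
qed

text \<open>Convergence of the series supplies the weak identity in \<open>reproducing_pair\<close>,
  which leaves the invertibility of \<open>S\<close>.\<close>

lemma reproducing_pair_iff_GL: "reproducing_pair H ip I \<psi> \<phi> \<longleftrightarrow> S \<in> GL H ip"
  using has_sum_frame_operator[OF \<psi> \<phi> conv] by (simp add: reproducing_pair_def)

lemma reproducing_pair_imp_kernel_expansion:
  assumes "reproducing_pair H ip I \<psi> \<phi>"
  shows "\<exists>A\<in>GL H ip. kernel_expansion H ip I \<psi> \<phi> A"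
proof -
  obtain A where "A \<in> GL H ip" "\<And>f. f \<in> H \<Longrightarrow> A (S f) = f" "\<And>f. f \<in> H \<Longrightarrow> S (A f) = f"
    using assms unfolding reproducing_pair_iff_GL by (rule GL_inverse) blast
  then show ?thesis using kernel_expansion_of_inverse GL_bounded_operator by blast
qed

lemma kernel_expansion_imp_inverse:
  assumes A: "A \<in> GL H ip" and exp: "kernel_expansion H ip I \<psi> \<phi> A" and f: "f \<in> H"
  shows "A (S f) = f" "S (A f) = f"
proof -
  have AS: "A (S h) = h" if "h \<in> H" for h
    using kernel_expansion_imp_left_inverse GL_bounded_operator A exp that by blast
  show "A (S f) = f" by (rule AS[OF f])
  show "S (A f) = f"
    using GL_left_inverse_imp_right_inverse[OF A _ AS f] S_mem by blast
qed

lemma kernel_expansion_imp_reproducing_pair: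
  assumes A: "A \<in> GL H ip" and exp: "kernel_expansion H ip I \<psi> \<phi> A"
  shows "reproducing_pair H ip I \<psi> \<phi>"
  unfolding reproducing_pair_iff_GL
  using kernel_expansion_imp_inverse[OF A exp] GL_bounded_operator[OF A]
    bounded_operator_frame_operator[OF \<psi> \<phi> conv]
  by (auto simp: GL_def)

text \<open>The choice made by \<open>inv_into\<close> is forced: the left inverse \<open>A\<close>
  makes \<open>S\<close> injective on \<open>H\<close>, and \<open>A f\<close> is a preimage of
  \<open>f\<close> in \<open>H\<close>.\<close>

lemma kernel_expansion_imp_eq_inv:
  assumes A: "A \<in> GL H ip" and exp: "kernel_expansion H ip I \<psi> \<phi> A" and f: "f \<in> H"
  shows "A f = inv_into H S f"
proof -
  have "inj_on S H"
    by (rule inj_on_inverseI[of H A]) (rule kernel_expansion_imp_inverse(1)[OF A exp])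
  moreover have "A f \<in> H"
    using A f GL_bounded_operator bounded_operator_mem by blast
  ultimately show ?thesis
    using kernel_expansion_imp_inverse(2)[OF A exp f] inv_into_f_f by metis
qed

end

end

theorem theorem4:
  fixes H :: "('z \<Rightarrow> complex) set" and ip :: "'z inner_prod"
    and I :: "'i set" and \<psi> \<phi> :: "'i \<Rightarrow> 'z \<Rightarrow> complex"
  assumes "rkhs H ip"
    and "countable I"
    and "\<And>i. i \<in> I \<Longrightarrow> \<psi> i \<in> H" and "\<And>i. i \<in> I \<Longrightarrow> \<phi> i \<in> H"
    and "frame_series_converge H ip I \<psi> \<phi>"
  shows "(reproducing_pair H ip I \<psi> \<phi> \<longleftrightarrow> (\<exists>A\<in>GL H ip. kernel_expansion H ip I \<psi> \<phi> A)) \<and>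
    (\<forall>A\<in>GL H ip. kernel_expansion H ip I \<psi> \<phi> A \<longrightarrow>
       (\<forall>f\<in>H. A f = inv_into H (frame_operator H ip I \<psi> \<phi>) f))"
proof -
  interpret rkhs H ip by fact
  note fam = assms(3-5)
  show ?thesis
    using reproducing_pair_imp_kernel_expansion[OF fam]
      kernel_expansion_imp_reproducing_pair[OF fam] kernel_expansion_imp_eq_inv[OF fam]
    by blast
qed

end
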